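(* Suppose that $\zeta:\{0,1\}\to\{0,1\}^{<\mathbb{N}}$ is a proper, constant-length substitution such that the word $V=\lim_{n\to\infty}\zeta^n(0)$ is aperiodic and the first and last letters of $\zeta(a)$ are different (for $a\in\{0,1\}$). Then $V$ has a spacer rank-two construction.
   Context: Substitutions: $\{0,1\}^{<\mathbb{N}}$ denotes the set of finite binary words. A substitution is a function $\zeta:\{0,1\}\to\{0,1\}^{<\mathbb{N}}$, extended to words by $\zeta(w_0w_1w_2\cdots)=\zeta(w_0)\zeta(w_1)\zeta(w_2)\cdots$, with the standing assumptions that $\zeta(0)$ starts with $0$ and has length greater than $1$, and $\lim_{n\to\infty}|\zeta^n(1)|=\infty$. Then $V=\lim_n\zeta^n(0)\in\{0,1\}^{\mathbb{N}}$ is the unique fixed point of $\zeta$ starting with $0$. The substitution is proper if $\zeta(0)$ and $\zeta(1)$ begin with the same letter and end with the same letter (the last letter may differ from the first). It has constant length if $|\zeta(0)|=|\zeta(1)|$. An infinite word $V$ is periodic if $V=vvv\cdots$ for some finite word $v$; aperiodic means not periodic. Building: $\mathbb{N}$ is the set of nonnegative integers; $\mathcal{F}$ is the set of all finite words that start and end with $0$; $1^a$ is $a$ consecutive $1$s. For finite $S\subset\mathcal{F}$, a finite word $w$ is built from $S$ if $w=v_11^{a_1}v_21^{a_2}\cdots v_k1^{a_k}v_{k+1}$ for some $k\ge 1$, $v_i\in S$, $a_i\in\mathbb{N}$; it is built from $S$ starting with $u$ if moreover one can take $v_1=u$. An infinite word $V$ has an at most spacer rank-$n$ construction if there are finite sets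 $S_i=\{v_{i,1},\dots,v_{i,n_i}\}\subset\mathcal{F}$ ($i\in\mathbb{N}$) with $1\le n_i\le n$ such that: $v_{0,j}=0$ for all $j$; $v_{i+1,1}$ is built from $S_i$ starting with $v_{i,1}$; $v_{i+1,j}$ is built from $S_i$ for all $2\le j\le n_{i+1}$; and $v_{i,1}$ is an initial segment of $V$ for all $i$. $V$ has a spacer rank-two construction if it has an at most spacer rank-$2$ construction but no at most spacer rank-$1$ construction. *)

theory Defs
  imports Complex_Main "HOL-Library.Z2"
begin

text \<open>The alphabet is the type \<open>bit\<close>; finite words are lists of bits and infinite words are
  functions \<open>nat \<Rightarrow> bit\<close>.\<close>

type_synonym word = "bit list"
type_synonym infinite_word = "nat \<Rightarrow> bit"

definition prefix_of_infinite :: "word \<Rightarrow> infinite_word \<Rightarrow> bool" where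
  "prefix_of_infinite w V \<longleftrightarrow> w = map V [0..<length w]"

text \<open>Letterwise limit of a sequence of finite words.\<close>

definition word_limit :: "(nat \<Rightarrow> word) \<Rightarrow> infinite_word \<Rightarrow> bool" where
  "word_limit X V \<longleftrightarrow>
     (\<forall>m. \<forall>\<^sub>F n in sequentially. m < length (X n) \<and> X n ! m = V m)"

definition periodic_word :: "infinite_word \<Rightarrow> bool" where
  "periodic_word V \<longleftrightarrow> (\<exists>v. v \<noteq> [] \<and> (\<forall>m. V m = v ! (m mod length v)))"


subsection \<open>Substitutions\<close>

definition subst_ext :: "(bit \<Rightarrow> word) \<Rightarrow> word \<Rightarrow> word" where
  "subst_ext \<zeta> w = concat (map \<zeta> w)"

definition substitution :: "(bit \<Rightarrow> word) \<Rightarrow> bool" where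
  "substitution \<zeta> \<longleftrightarrow>
     \<zeta> 0 \<noteq> [] \<and> hd (\<zeta> 0) = 0 \<and> length (\<zeta> 0) > 1 \<and>
     filterlim (\<lambda>n. length ((subst_ext \<zeta> ^^ n) [1])) at_top sequentially"

definition proper_subst :: "(bit \<Rightarrow> word) \<Rightarrow> bool" where
  "proper_subst \<zeta> \<longleftrightarrow>
     \<zeta> 0 \<noteq> [] \<and> \<zeta> 1 \<noteq> [] \<and> hd (\<zeta> 0) = hd (\<zeta> 1) \<and> last (\<zeta> 0) = last (\<zeta> 1)"

definition constant_length :: "(bit \<Rightarrow> word) \<Rightarrow> bool" where
  "constant_length \<zeta> \<longleftrightarrow> length (\<zeta> 0) = length (\<zeta> 1)"


subsection \<open>Spacer rank\<close>

definition zero_bounded_words :: "word set" where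
  "zero_bounded_words = {w. w \<noteq> [] \<and> hd w = 0 \<and> last w = 0}"

text \<open>The word \<open>v\<^sub>1 1\<^bsup>a\<^sub>1\<^esup> v\<^sub>2 1\<^bsup>a\<^sub>2\<^esup> \<dots> v\<^sub>k 1\<^bsup>a\<^sub>k\<^esup> v\<^sub>k\<^sub>+\<^sub>1\<close>.\<close>

definition spaced_concat :: "(nat \<Rightarrow> word) \<Rightarrow> (nat \<Rightarrow> nat) \<Rightarrow> nat \<Rightarrow> word" where
  "spaced_concat v a k =
     concat (map (\<lambda>i. v i @ replicate (a i) 1) [1..<k + 1]) @ v (k + 1)"

definition built_from :: "word set \<Rightarrow> word \<Rightarrow> bool" where
  "built_from S w \<longleftrightarrow>
     (\<exists>k v a. k \<ge> 1 \<and> (\<forall>i\<in>{1..k + 1}. v i \<in> S) \<and> w = spaced_concat v a k)"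

definition built_from_starting :: "word set \<Rightarrow> word \<Rightarrow> word \<Rightarrow> bool" where
  "built_from_starting S u w \<longleftrightarrow>
     (\<exists>k v a. k \<ge> 1 \<and> (\<forall>i\<in>{1..k + 1}. v i \<in> S) \<and> w = spaced_concat v a k \<and> v 1 = u)"

text \<open>The family \<open>v i 1, \<dots>, v i (N i)\<close> enumerates the finite set \<open>S\<^sub>i\<close>, possibly with
  repetitions; values of \<open>v i\<close> outside \<open>{1..N i}\<close> are irrelevant.\<close>

definition at_most_spacer_rank :: "nat \<Rightarrow> infinite_word \<Rightarrow> bool" where
  "at_most_spacer_rank n V \<longleftrightarrow>
     (\<exists>(N :: nat \<Rightarrow> nat) (v :: nat \<Rightarrow> nat \<Rightarrow> word).
        (\<forall>i. 1 \<le> N i \<and> N i \<le> n) \<and>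
        (\<forall>i. v i ` {1..N i} \<subseteq> zero_bounded_words) \<and>
        (\<forall>j\<in>{1..N 0}. v 0 j = [0]) \<and>
        (\<forall>i. built_from_starting (v i ` {1..N i}) (v i 1) (v (Suc i) 1)) \<and>
        (\<forall>i. \<forall>j\<in>{2..N (Suc i)}. built_from (v i ` {1..N i}) (v (Suc i) j)) \<and>
        (\<forall>i. prefix_of_infinite (v i 1) V))"

definition spacer_rank_two :: "infinite_word \<Rightarrow> bool" where
  "spacer_rank_two V \<longleftrightarrow> at_most_spacer_rank 2 V \<and> \<not> at_most_spacer_rank 1 V"

end

theory Submission
  imports Defs
begin

text \<open>Under the hypotheses both \<open>\<zeta> 0\<close> and \<open>\<zeta> 1\<close> start with 0, end with 1 and have the same length
  \<open>l\<close>. Deleting the trailing 1s of \<open>\<zeta>\<^sup>n(0)\<close> and \<open>\<zeta>\<^sup>n(1)\<close> gives the rank-two construction.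

  For the lower bound, a long prefix of \<open>V\<close> occurs in \<open>V\<close> only at multiples of \<open>l\<close>. If \<open>V\<close> had a
  rank-one construction with a long word \<open>v\<close>, consecutive copies of \<open>v\<close> would therefore be separated
  by \<open>1\<^sup>a\<close> with \<open>|v| + a\<close> divisible by \<open>l\<close>; runs of 1s in \<open>V\<close> are shorter than \<open>l\<close>, so \<open>a\<close> is always
  the same and \<open>V\<close> is periodic.\<close>

section \<open>Words built from a set\<close>

lemma spaced_concat_0: "spaced_concat v a 0 = v 1"
  by (simp add: spaced_concat_def)

lemma spaced_concat_Suc:
  "spaced_concat v a (Suc k) = spaced_concat v a k @ replicate (a (Suc k)) 1 @ v (Suc (Suc k))"
  by (simp add: spaced_concat_def)

lemma spaced_concat_cong:
  assumes "\<And>i. 1 \<le> i \<Longrightarrow> i \<le> k + 1 \<Longrightarrow> v i = v' i" "\<And>i. 1 \<le> i \<Longrightarrow> i \<le> k \<Longrightarrow> a i = a' i"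
  shows "spaced_concat v a k = spaced_concat v' a' k"
  using assms by (induction k) (simp_all add: spaced_concat_0 spaced_concat_Suc)

lemma built_from_starting_imp_built_from: "built_from_starting S u w \<Longrightarrow> built_from S w"
  unfolding built_from_starting_def built_from_def by blast

text \<open>\<open>built_from_starting\<close> asks for at least two factors
  (\<open>k \<ge> 1\<close>); the disjunct \<open>w = u\<close> restores the one-factor case, from
  which inductions start.\<close>

definition eq_or_built :: "word set \<Rightarrow> word \<Rightarrow> word \<Rightarrow> bool" where
  "eq_or_built S u w \<longleftrightarrow> w = u \<or> built_from_starting S u w"

lemma eq_or_built_iff:
  assumes "u \<in> S"
  shows "eq_or_built S u w \<longleftrightarrow>
    (\<exists>k v a. (\<forall>i\<in>{1..k + 1}. v i \<in> S) \<and> w = spaced_concat v a k \<and> v 1 = u)" (is "_ \<longleftrightarrow> ?R")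
proof
  assume "eq_or_built S u w"
  then consider "w = u" | "built_from_starting S u w"
    unfolding eq_or_built_def by blast
  then show ?R
  proof cases
    case 1
    then show ?thesis
      using assms by (intro exI[of _ 0] exI[of _ "\<lambda>_. u"] exI) (auto simp: spaced_concat_0)
  next
    case 2
    then show ?thesis unfolding built_from_starting_def by blast
  qed
next
  assume ?R
  then obtain k v a where *: "\<forall>i\<in>{1..k + 1}. v i \<in> S" "w = spaced_concat v a k" "v 1 = u"
    by blast
  show "eq_or_built S u w"
  proof (cases "k = 0")
    case True
    with * show ?thesis by (simp add: eq_or_built_def spaced_concat_0)
  next
    case False
    then have "k \<ge> 1" by simp
    with * show ?thesis unfolding eq_or_built_def built_from_starting_def by blast
  qed
qed

lemma built_from_starting_snoc:
  assumes "u \<in> S" "z \<in> S" "eq_or_built S u w"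
  shows "built_from_starting S u (w @ replicate b 1 @ z)"
proof -
  obtain k v a where *: "\<forall>i\<in>{1..k + 1}. v i \<in> S" "w = spaced_concat v a k" "v 1 = u"
    using assms eq_or_built_iff by meson
  let ?v = "v(Suc (Suc k) := z)" and ?a = "a(Suc k := b)"
  have "spaced_concat ?v ?a k = w"
    unfolding *(2) by (rule spaced_concat_cong) auto
  then have "w @ replicate b 1 @ z = spaced_concat ?v ?a (Suc k)"
    by (simp add: spaced_concat_Suc)
  moreover have "\<forall>i\<in>{1..Suc k + 1}. ?v i \<in> S" "?v 1 = u"
    using * assms by auto
  ultimately show ?thesis
    unfolding built_from_starting_def by (metis Suc_eq_plus1 le_add2)
qed

lemma built_from_starting_hd_last:
  assumes "built_from_starting S u w" "S \<subseteq> zero_bounded_words"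
  shows "w \<in> zero_bounded_words"
proof -
  obtain k v a where *: "\<forall>i\<in>{1..k + 1}. v i \<in> S" "w = spaced_concat v a k"
    using assms unfolding built_from_starting_def by blast
  have "spaced_concat v a k \<in> zero_bounded_words"
    using * assms(2)
  proof (induction k arbitrary: w)
    case 0
    then show ?case by (auto simp: spaced_concat_0)
  next
    case (Suc k)
    have "spaced_concat v a k \<in> zero_bounded_words"
      using Suc.prems by (intro Suc.IH[OF _ refl]) auto
    moreover have "v (Suc (Suc k)) \<in> zero_bounded_words"
      using Suc.prems by auto
    ultimately show ?case
      by (auto simp: zero_bounded_words_def spaced_concat_Suc)
  qed
  with * show ?thesis by simp
qed

text \<open>The trailing ones of each block become the spacer before the next block; only those of
  the last block remain, as \<open>c\<close>. Later \<open>g\<close> sends a letter to its image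
  under an iterate of \<zeta>, and \<open>u @ replicate d 1\<close> is the image of a leading
  0.\<close>

lemma built_from_starting_append_ones:
  assumes "u \<in> S" "\<And>b. b \<in> set bs \<Longrightarrow> \<exists>z\<in>S. \<exists>c. g b = z @ replicate c 1"
    and "bs \<noteq> []"
  shows "\<exists>w c. u @ replicate d 1 @ concat (map g bs) = w @ replicate c 1 \<and> built_from_starting S u w"
  using assms(2,3)
proof (induction bs rule: rev_induct)
  case Nil
  then show ?case by simp
next
  case (snoc b bs)
  obtain z c where z: "z \<in> S" "g b = z @ replicate c 1"
    using snoc.prems by fastforce
  have "\<exists>w c. u @ replicate d 1 @ concat (map g bs) = w @ replicate c 1 \<and> eq_or_built S u w"
  proof (cases "bs = []")
    case True
    then show ?thesis by (auto simp: eq_or_built_def)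
  next
    case False
    then show ?thesis
      using snoc unfolding eq_or_built_def by (metis Un_iff set_append)
  qed
  then obtain w e where w: "u @ replicate d 1 @ concat (map g bs) = w @ replicate e 1"
      "eq_or_built S u w"
    by blast
  have "u @ replicate d 1 @ concat (map g (bs @ [b])) = (w @ replicate e 1 @ z) @ replicate c 1"
  proof -
    have "u @ replicate d 1 @ concat (map g (bs @ [b])) =
        (u @ replicate d 1 @ concat (map g bs)) @ g b"
      by simp
    then show ?thesis by (simp add: w(1) z(2))
  qed
  then show ?case
    using built_from_starting_snoc[OF assms(1) z(1) w(2)] by blast
qed

text \<open>Reading letter by letter, each 0 is a new factor and each 1 lengthens the pending
  spacer.\<close>

lemma zero_first_decomp:
  "\<exists>w c. (0 :: bit) # x = w @ replicate c 1 \<and> eq_or_built {[0]} [0] w"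
proof (induction x rule: rev_induct)
  case Nil
  then show ?case by (auto simp: eq_or_built_def intro: exI[of _ "[0]"])
next
  case (snoc b x)
  then obtain w c where w: "0 # x = w @ replicate c 1" "eq_or_built {[0]} [0] w" by blast
  show ?case
  proof (cases b)
    case zero
    have "0 # x @ [b] = (w @ replicate c 1 @ [0]) @ replicate 0 1"
      using w zero by (metis append.assoc append_Cons append_Nil2 replicate_0)
    then show ?thesis
      using built_from_starting_snoc[of "[0]" "{[0]}" "[0]" w c] w(2)
      unfolding eq_or_built_def by blast
  next
    case one
    have "0 # x @ [b] = w @ replicate (Suc c) 1"
      using w one by (metis append.assoc append_Cons replicate_Suc replicate_append_same)
    then show ?thesis using w(2) by blast
  qed
qed

lemma built_from_zero:
  assumes "x \<in> zero_bounded_words" "length x > 1"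
  shows "built_from_starting {[0]} [0] x"
proof -
  obtain y where y: "x = 0 # y @ [0]"
    using assms unfolding zero_bounded_words_def
    by (cases x; cases "tl x" rule: rev_cases) auto
  obtain w c where w: "0 # y = w @ replicate c 1" "eq_or_built {[0]} [0] w"
    using zero_first_decomp by blast
  have "x = w @ replicate c 1 @ [0]"
    using y w(1) by (metis append.assoc append_Cons)
  then show ?thesis
    using built_from_starting_snoc[of "[0]" "{[0]}" "[0]" w c] w(2) by simp
qed

lemma strip_ones_exists:
  assumes "w \<noteq> []" "w ! 0 = 0"
  shows "\<exists>u c. w = u @ replicate c 1 \<and> u \<in> zero_bounded_words"
proof -
  obtain x where "w = 0 # x" using assms by (cases w) auto
  then obtain u c where u: "w = u @ replicate c 1" "eq_or_built {[0]} [0] u"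
    using zero_first_decomp[of x] by auto
  have zero: "{[0]} \<subseteq> zero_bounded_words"
    by (simp add: zero_bounded_words_def)
  have "u \<in> zero_bounded_words"
    using u(2) zero built_from_starting_hd_last[OF _ zero] by (auto simp: eq_or_built_def)
  with u(1) show ?thesis by blast
qed

lemma strip_ones_unique:
  assumes "u @ replicate c 1 = u' @ replicate c' 1"
    and "u \<in> zero_bounded_words" "u' \<in> zero_bounded_words"
  shows "u = u'"
proof -
  \<comment> \<open>Since \<open>x\<close> ends in 0, removing ones from the end stops exactly at
    its last letter.\<close>
  have *: "dropWhile ((=) 1) (rev (x @ replicate d (1 :: bit))) = rev x"
    if "x \<in> zero_bounded_words" for x d
  proof -
    obtain y where "x = y @ [0]"
      using \<open>x \<in> zero_bounded_words\<close> by (cases x rule: rev_cases) (auto simp: zero_bounded_words_def)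
    moreover have "dropWhile ((=) 1) (replicate d 1 @ 0 # z) = (0 :: bit) # z" for z
      by (induction d) simp_all
    ultimately show ?thesis by simp
  qed
  show ?thesis using *[OF assms(2), of c] *[OF assms(3), of c'] assms(1) by simp
qed

text \<open>Forgets the levels of a construction: in the rank-one case all words above a given level
  lie in the closure of one word, so a single induction treats them all.\<close>

inductive_set spaced_closure :: "word set \<Rightarrow> word set" for S where
  base: "x \<in> S \<Longrightarrow> x \<in> spaced_closure S"
| join: "x \<in> spaced_closure S \<Longrightarrow> y \<in> spaced_closure S \<Longrightarrow>
    x @ replicate a 1 @ y \<in> spaced_closure S"

lemma built_from_starting_in_spaced_closure:
  assumes "built_from_starting S' u w" "S' \<subseteq> spaced_closure S"
  shows "w \<in> spaced_closure S"
proof -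
  obtain k v a where *: "\<forall>i\<in>{1..k + 1}. v i \<in> S'" "w = spaced_concat v a k"
    using assms unfolding built_from_starting_def by blast
  have "spaced_concat v a k \<in> spaced_closure S"
    using *(1) assms(2)
    by (induction k) (auto simp: spaced_concat_0 spaced_concat_Suc intro!: spaced_closure.join)
  with * show ?thesis by simp
qed

lemma built_from_starting_longer:
  assumes "built_from_starting S u w" "S \<subseteq> zero_bounded_words"
  shows "length u < length w"
proof -
  obtain k v a where *: "k \<ge> 1" "\<forall>i\<in>{1..k + 1}. v i \<in> S" "w = spaced_concat v a k" "v 1 = u"
    using assms unfolding built_from_starting_def by blast
  \<comment> \<open>The induction starts at two factors, since a single factor has the length of
    \<open>u\<close>.\<close>
  have "length u < length (spaced_concat v a (Suc j))" if "\<forall>i\<in>{1..Suc j + 1}. v i \<in> S" for j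
    using that
  proof (induction j)
    case 0
    then show ?case using assms(2) *(4)
      by (auto simp: spaced_concat_0 spaced_concat_Suc zero_bounded_words_def)
  next
    case (Suc j)
    then show ?case by (subst spaced_concat_Suc) (fastforce intro: trans_less_add1)
  qed
  then show ?thesis using * by (metis Suc_pred' less_eq_Suc_le One_nat_def)
qed

section \<open>Constant-length substitutions\<close>

lemma length_subst_ext:
  assumes "\<And>a. length (\<zeta> a) = l"
  shows "length (subst_ext \<zeta> w) = length w * l"
  by (induction w) (simp_all add: subst_ext_def assms)

lemma nth_subst_ext:
  assumes "\<And>a. length (\<zeta> a) = l" "k < length w" "c < l"
  shows "subst_ext \<zeta> w ! (k * l + c) = \<zeta> (w ! k) ! c"
  using assms(2)
proof (induction w arbitrary: k)
  case (Cons b w)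
  then show ?case
    using assms(1,3) by (cases k) (auto simp: subst_ext_def nth_append)
qed simp

lemma subst_ext_append: "subst_ext \<zeta> (x @ y) = subst_ext \<zeta> x @ subst_ext \<zeta> y"
  by (simp add: subst_ext_def)

lemma subst_ext_funpow_append:
  "(subst_ext \<zeta> ^^ n) (x @ y) = (subst_ext \<zeta> ^^ n) x @ (subst_ext \<zeta> ^^ n) y"
  by (induction n) (simp_all add: subst_ext_append)

lemma subst_ext_funpow_concat:
  "(subst_ext \<zeta> ^^ n) w = concat (map (\<lambda>b. (subst_ext \<zeta> ^^ n) [b]) w)"
proof (induction w)
  case Nil
  show ?case by (induction n) (simp_all add: subst_ext_def)
next
  case (Cons b w)
  then show ?case
    by (simp only: subst_ext_funpow_append[of n \<zeta> "[b]" w, simplified append.simps]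
        list.map concat.simps)
qed

lemma subst_ext_funpow_Suc_letter:
  "(subst_ext \<zeta> ^^ Suc n) [a] = (subst_ext \<zeta> ^^ n) (\<zeta> a)"
proof -
  have "subst_ext \<zeta> [a] = \<zeta> a"
    by (simp add: subst_ext_def)
  then show ?thesis
    unfolding funpow_Suc_right o_def by (rule arg_cong)
qed

lemma length_subst_ext_funpow:
  assumes "\<And>a. length (\<zeta> a) = l"
  shows "length ((subst_ext \<zeta> ^^ n) w) = length w * l ^ n"
  by (induction n) (simp_all add: length_subst_ext[OF assms])

section \<open>Occurrences in infinite words and prefixes of the limit word\<close>

definition occurs_at :: "word \<Rightarrow> nat \<Rightarrow> infinite_word \<Rightarrow> bool" where
  "occurs_at w p V \<longleftrightarrow> (\<forall>t<length w. w ! t = V (p + t))"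

lemma prefix_of_infinite_iff_occurs_at: "prefix_of_infinite w V \<longleftrightarrow> occurs_at w 0 V"
  unfolding prefix_of_infinite_def occurs_at_def list_eq_iff_nth_eq by simp

lemma occurs_at_append:
  "occurs_at (x @ y) p V \<longleftrightarrow> occurs_at x p V \<and> occurs_at y (p + length x) V" (is "?L \<longleftrightarrow> ?R")
proof
  assume L: ?L
  have "y ! t = V (p + length x + t)" if "t < length y" for t
    using L[unfolded occurs_at_def, rule_format, of "length x + t"] that
    by (simp add: nth_append add.assoc)
  moreover have "x ! t = V (p + t)" if "t < length x" for t
    using L[unfolded occurs_at_def, rule_format, of t] that by (simp add: nth_append)
  ultimately show ?R unfolding occurs_at_def by blast
next
  assume R: ?R
  show ?L unfolding occurs_at_def
  proof (intro allI impI)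
    fix t assume t: "t < length (x @ y)"
    show "(x @ y) ! t = V (p + t)"
    proof (cases "t < length x")
      case True
      then show ?thesis using R by (simp add: occurs_at_def nth_append)
    next
      case False
      then show ?thesis
        using R t by (auto simp: occurs_at_def nth_append dest: spec[of _ "t - length x"])
    qed
  qed
qed

text \<open>A letterwise limit only controls late iterates. As \<open>\<zeta> 0\<close> starts with
  0, each iterate is a prefix of the next, which carries the information back to the
  \<open>n\<close>-th one.\<close>

lemma word_limit_prefix:
  assumes "\<And>a. length (\<zeta> a) = l" "l > 1" "\<zeta> 0 ! 0 = 0"
    and "word_limit (\<lambda>n. (subst_ext \<zeta> ^^ n) [0]) V"
  shows "occurs_at ((subst_ext \<zeta> ^^ n) [0]) 0 V"
  unfolding occurs_at_def
proof (intro allI impI)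
  fix t assume t: "t < length ((subst_ext \<zeta> ^^ n) [0])"
  let ?X = "\<lambda>n. (subst_ext \<zeta> ^^ n) [0]"
  obtain z where z: "\<zeta> 0 = [0] @ z"
    using assms(1)[of 0] assms(2,3) by (cases "\<zeta> 0") auto
  have step: "?X (Suc m) = ?X m @ (subst_ext \<zeta> ^^ m) z" for m
    unfolding subst_ext_funpow_Suc_letter z by (rule subst_ext_funpow_append)
  have pre: "t < length (?X (n + d)) \<and> ?X (n + d) ! t = ?X n ! t" for d
  proof (induction d)
    case (Suc d)
    then show ?case unfolding add_Suc_right step by (simp add: nth_append)
  qed (use t in simp)
  obtain N where "\<forall>m\<ge>N. ?X m ! t = V t"
    using assms(4) unfolding word_limit_def eventually_sequentially by blast
  then have "?X (n + N) ! t = V t" by simp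
  with pre show "?X n ! t = V (0 + t)" by simp
qed

lemma nth_concat_replicate:
  assumes "m < n * length u"
  shows "concat (replicate n u) ! m = u ! (m mod length u)"
  using assms
proof (induction n arbitrary: m)
  case (Suc n)
  then show ?case
    by (cases "m < length u") (auto simp: nth_append le_mod_geq)
qed simp

text \<open>Addition is modulo 2, so adding the two equations cancels \<open>z\<close>.\<close>

lemma bit_eliminate:
  fixes x y z :: bit
  assumes "x + a = z + b" "y + c = z + d"
  shows "x = y + (a + b + c + d)"
  using assms
  by (cases a; cases b; cases c; cases d; cases x; cases y; cases z) simp_all

section \<open>Fixed points whose blocks start with 0 and end with 1\<close>

locale zero_one_fixed_point =
  fixes \<zeta> :: "bit \<Rightarrow> word" and V :: infinite_word and l :: nat
  assumes length_block: "length (\<zeta> a) = l"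
    and l_gt_1: "l > 1"
    and first_letter: "\<zeta> a ! 0 = 0"
    and last_letter: "\<zeta> a ! (l - 1) = 1"
    and prefix: "occurs_at ((subst_ext \<zeta> ^^ n) [0]) 0 V"
begin

text \<open>Because \<open>k < l ^ k\<close>, the letter \<open>V k\<close> lies in the
  \<open>k\<close>-th iterate, and its block lies in the next iterate; both are prefixes of
  \<open>V\<close>.\<close>

lemma fixed_point:
  assumes "c < l"
  shows "V (k * l + c) = \<zeta> (V k) ! c"
proof -
  let ?X = "\<lambda>n. (subst_ext \<zeta> ^^ n) [0]"
  have len: "length (?X n) = l ^ n" for n
    using length_subst_ext_funpow[of \<zeta> l n "[0]"] length_block by simp
  have k: "k < l ^ k"
    using less_exp[of k] power_mono[of 2 l k] l_gt_1 by linarith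
  have "(k + 1) * l \<le> l ^ k * l"
    using k by (intro mult_right_mono) auto
  then have "k * l + c < l ^ Suc k"
    using assms by (simp add: mult.commute)
  then have "V (k * l + c) = ?X (Suc k) ! (k * l + c)"
    using prefix[of "Suc k"] unfolding occurs_at_def len by simp
  also have "\<dots> = \<zeta> (?X k ! k) ! c"
    using nth_subst_ext[of \<zeta> l k "?X k" c] length_block k len assms by simp
  also have "?X k ! k = V k"
    using prefix[of k] k unfolding occurs_at_def len by simp
  finally show ?thesis .
qed

lemma V_mult: "V (k * l) = 0"
  using fixed_point[of 0 k] l_gt_1 first_letter by simp

lemma V_before_mult: "V (k * l + (l - 1)) = 1"
  using fixed_point[of "l - 1" k] l_gt_1 last_letter by simp

lemma V_ones_run:
  assumes "occurs_at (replicate a 1) p V"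
  shows "a < l"
proof (rule ccontr)
  assume "\<not> a < l"
  \<comment> \<open>\<open>k * l\<close> is the least multiple of \<open>l\<close> that is at least
    \<open>p\<close>; every window of length \<open>l\<close> contains one.\<close>
  define k where "k = (p + l - 1) div l"
  have "p + l - 1 = k * l + (p + l - 1) mod l"
    unfolding k_def by simp
  moreover have "(p + l - 1) mod l < l"
    using l_gt_1 by simp
  ultimately have "p \<le> k * l" "k * l < p + l"
    using l_gt_1 by linarith+
  then have "V (k * l) = 1"
    using assms \<open>\<not> a < l\<close> unfolding occurs_at_def
    by (auto dest: spec[of _ "k * l - p"])
  with V_mult show False by simp
qed

text \<open>A window of length \<open>l\<close> meets every residue modulo \<open>l\<close>, in
  particular 0, where \<open>V\<close> is 0, and \<open>l - 1\<close>, where \<open>V\<close> is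
  1.\<close>

lemma V_both_letters: "\<exists>k<l. V (q + k) = 0" "\<exists>k<l. V (q + k) = 1"
proof -
  have ex: "\<exists>k<l. \<exists>j. q + k = j * l + c" if "c < l" for c
  proof -
    \<comment> \<open>The summand \<open>l\<close> keeps the subtraction from being
      truncated.\<close>
    let ?k = "(c + l - q mod l) mod l"
    have "(q + ?k) mod l = (q mod l + (c + l - q mod l)) mod l"
      by (simp add: mod_add_right_eq mod_add_left_eq mod_add_eq)
    also have "q mod l + (c + l - q mod l) = c + l"
      using l_gt_1 by (simp add: less_imp_le trans_le_add2)
    finally have "(q + ?k) mod l = c" using that by simp
    then have "q + ?k = (q + ?k) div l * l + c"
      by (metis div_mult_mod_eq)
    moreover have "?k < l" using l_gt_1 by simp
    ultimately show ?thesis by blast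
  qed
  show "\<exists>k<l. V (q + k) = 0" using ex[of 0] l_gt_1 V_mult by force
  show "\<exists>k<l. V (q + k) = 1" using ex[of "l - 1"] l_gt_1 V_before_mult by force
qed

section \<open>Recognizing block boundaries from the columns that distinguish the blocks\<close>

text \<open>In these columns a block reveals the letter it comes from, up to a fixed shift modulo 2;
  in all others it reveals nothing.\<close>

definition diff_columns :: "nat set" where
  "diff_columns = {c. c < l \<and> \<zeta> 0 ! c \<noteq> \<zeta> 1 ! c}"

lemma nth_block_diff: "c \<in> diff_columns \<Longrightarrow> \<zeta> a ! c = a + \<zeta> 0 ! c"
  by (cases a; cases "\<zeta> 0 ! c"; cases "\<zeta> 1 ! c") (auto simp: diff_columns_def)

lemma nth_block_same: "c < l \<Longrightarrow> c \<notin> diff_columns \<Longrightarrow> \<zeta> a ! c = \<zeta> 0 ! c"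
  by (cases a) (auto simp: diff_columns_def)

text \<open>Outside \<open>diff_columns\<close> column \<open>c'\<close> is constant, whereas column
  \<open>c\<close> takes two values once \<open>x\<close> takes both letters.\<close>

lemma diff_columns_transfer:
  assumes "\<And>k. k < M \<Longrightarrow> \<zeta> (x k) ! c = \<zeta> (y k) ! c'" "c' < l" "c \<in> diff_columns"
    and "\<exists>k<M. x k = 0" "\<exists>k<M. x k = 1"
  shows "c' \<in> diff_columns"
proof (rule ccontr)
  assume "c' \<notin> diff_columns"
  then have "\<zeta> (x k) ! c = \<zeta> 0 ! c'" if "k < M" for k
    using assms(1)[OF that] nth_block_same[OF assms(2), of "y k"] by metis
  then have "\<zeta> 0 ! c = \<zeta> 1 ! c"
    using assms(4,5) by metis
  with assms(3) show False by (simp add: diff_columns_def)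
qed

text \<open>Otherwise both blocks coincide and \<open>V\<close> repeats
  \<open>\<zeta> 0\<close>.\<close>

lemma diff_columns_nonempty:
  assumes "\<not> periodic_word V"
  shows "diff_columns \<noteq> {}"
proof
  assume "diff_columns = {}"
  then have "V m = \<zeta> 0 ! (m mod length (\<zeta> 0))" for m
    using fixed_point[of "m mod l" "m div l"] nth_block_same[of "m mod l" "V (m div l)"] l_gt_1
      length_block by simp
  moreover have "\<zeta> 0 \<noteq> []" using length_block[of 0] l_gt_1 by auto
  ultimately show False using assms unfolding periodic_word_def by blast
qed

text \<open>An occurrence at \<open>q * l + r\<close> with \<open>0 < r < l\<close> makes the set of columns where \<open>\<zeta> 0\<close> and \<open>\<zeta> 1\<close>
  differ invariant under rotation by \<open>r\<close>. Comparing letters in its least column, which does not wrap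
  around, and in its greatest column, which does, shows that \<open>V (k + 1) - V k\<close> does not depend on
  \<open>k\<close>.\<close>

lemma prefix_occurs_only_at_multiples:
  assumes "\<not> periodic_word V"
  shows "\<exists>L. \<forall>p. (\<forall>t<L. V (p + t) = V t) \<longrightarrow> l dvd p"
proof -
  \<comment> \<open>Without two equal neighbours \<open>V\<close> would be 010101..., which is
    periodic.\<close>
  obtain m where m: "V (Suc m) = V m"
  proof (rule ccontr)
    assume "\<not> thesis"
    with that have alt: "V (Suc m) \<noteq> V m" for m by blast
    have "V m = (if even m then 0 else 1)" for m
    proof (induction m)
      case 0
      then show ?case using V_mult[of 0] by simp
    next
      case (Suc m)
      then show ?case using alt[of m] by (cases "V (Suc m)") (auto split: if_splits)
    qed
    then have "V m = [0, 1] ! (m mod 2)" for m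
      by (cases "even m") (simp_all add: even_iff_mod_2_eq_zero odd_iff_mod_2_eq_one)
    then have "V m = [0, 1] ! (m mod length [0 :: bit, 1])" for m
      by (simp add: numeral_2_eq_2)
    then show False using assms unfolding periodic_word_def by blast
  qed
  \<comment> \<open>Large enough that the first \<open>M\<close> letters include both 0 and 1
    (\<open>l < M\<close>) and that positions \<open>m\<close> and \<open>Suc m\<close> lie among
    them.\<close>
  define M where "M = m + l + 2"
  have "l dvd p" if occ: "\<forall>t<M * l. V (p + t) = V t" for p
  proof (rule ccontr)
    assume "\<not> l dvd p"
    define q r where "q = p div l" and "r = p mod l"
    have p: "p = q * l + r" and r: "0 < r" "r < l"
      using \<open>\<not> l dvd p\<close> l_gt_1 by (auto simp: q_def r_def dvd_eq_mod_eq_0)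
    have shifted: "\<zeta> (V k) ! c = V (q * l + r + (k * l + c))" if "k < M" "c < l" for k c
    proof -
      have "(k + 1) * l \<le> M * l"
        using that by (intro mult_right_mono) auto
      then have "k * l + c < M * l"
        using that by simp
      with occ that show ?thesis by (simp add: p fixed_point)
    qed
    \<comment> \<open>Copied to position \<open>p\<close>, block \<open>k\<close> straddles blocks
      \<open>q + k\<close> and \<open>Suc q + k\<close>; its columns below \<open>l - r\<close> fall
      into the former, the others wrap into the latter.\<close>
    have nowrap: "\<zeta> (V k) ! c = \<zeta> (V (q + k)) ! (c + r)" if "k < M" "c + r < l" for k c
    proof -
      have "q * l + r + (k * l + c) = (q + k) * l + (c + r)"
        by (simp add: algebra_simps)
      with shifted[of k c] fixed_point[of "c + r" "q + k"] that show ?thesis by simp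
    qed
    have wrap: "\<zeta> (V k) ! c = \<zeta> (V (Suc q + k)) ! (c + r - l)"
      if "k < M" "c < l" "l \<le> c + r" for k c
    proof -
      have "q * l + r + (k * l + c) = (Suc q + k) * l + (c + r - l)"
        using that by (simp add: algebra_simps)
      with shifted[of k c] fixed_point[of "c + r - l" "Suc q + k"] that r show ?thesis by simp
    qed
    have "k < M" if "k < l" for k
      using that by (simp add: M_def)
    then have both: "\<exists>k<M. V k = 0" "\<exists>k<M. V k = 1"
      using V_both_letters[of 0] by (metis add_0)+
    have fin: "finite diff_columns" and ne: "diff_columns \<noteq> {}"
      using diff_columns_nonempty[OF assms] by (simp_all add: diff_columns_def)
    define c1 c2 where "c1 = Min diff_columns" and "c2 = Max diff_columns"
    have c1: "c1 \<in> diff_columns" "c1 < l" and c2: "c2 \<in> diff_columns" "c2 < l"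
      using Min_in[OF fin ne] Max_in[OF fin ne] by (auto simp: c1_def c2_def diff_columns_def)
    have rotate: "c + r \<in> diff_columns" if "c \<in> diff_columns" "c + r < l" for c
      using nowrap that(2)
      by (intro diff_columns_transfer[OF _ that(2,1) both, where y = "\<lambda>k. V (q + k)"])
    have rotate_wrap: "c + r - l \<in> diff_columns" if "c \<in> diff_columns" "l \<le> c + r" for c
    proof -
      have "c < l" using that by (simp add: diff_columns_def)
      then have "c + r - l < l" using r by simp
      then show ?thesis
        using wrap[OF _ \<open>c < l\<close> that(2)]
        by (intro diff_columns_transfer[OF _ _ that(1) both, where y = "\<lambda>k. V (Suc q + k)"])
    qed
    \<comment> \<open>As \<open>0 < r < l\<close>, wrapping the minimum would give a smaller
      element; likewise, not wrapping the maximum would give a larger one.\<close>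
    have c1r: "c1 + r < l"
    proof (rule ccontr)
      assume wraps: "\<not> c1 + r < l"
      then have "c1 \<le> c1 + r - l"
        using rotate_wrap[OF c1(1)] Min_le[OF fin, folded c1_def] by simp
      with r wraps show False by linarith
    qed
    have c2r: "l \<le> c2 + r"
    proof (rule ccontr)
      assume "\<not> l \<le> c2 + r"
      then have "c2 + r \<in> diff_columns"
        using rotate[OF c2(1)] by simp
      then have "c2 + r \<le> c2"
        unfolding c2_def by (intro Max_ge[OF fin])
      with r show False by simp
    qed
    note c1r_diff = rotate[OF c1(1) c1r] and c2r_diff = rotate_wrap[OF c2(1) c2r]
    \<comment> \<open>Column \<open>c1\<close> of block \<open>Suc k\<close> and column
      \<open>c2\<close> of block \<open>k\<close> both land in the block of
      \<open>V (Suc (q + k))\<close>; eliminating that letter leaves the constant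
      \<open>h\<close>.\<close>
    define h where "h = \<zeta> 0 ! c1 + \<zeta> 0 ! (c1 + r) + \<zeta> 0 ! c2 + \<zeta> 0 ! (c2 + r - l)"
    have step: "V (Suc k) = V k + h" if "Suc k < M" for k
    proof -
      have "V (Suc k) + \<zeta> 0 ! c1 = V (Suc (q + k)) + \<zeta> 0 ! (c1 + r)"
        using nowrap[of "Suc k" c1] that c1r
        by (simp add: nth_block_diff[OF c1(1), of "V (Suc k)"]
            nth_block_diff[OF c1r_diff, of "V (Suc (q + k))"])
      moreover have "V k + \<zeta> 0 ! c2 = V (Suc (q + k)) + \<zeta> 0 ! (c2 + r - l)"
        using wrap[of k c2] that c2r c2
        by (simp add: nth_block_diff[OF c2(1), of "V k"]
            nth_block_diff[OF c2r_diff, of "V (Suc (q + k))"])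
      ultimately show ?thesis
        unfolding h_def by (rule bit_eliminate)
    qed
    show False
    \<comment> \<open>\<open>h = 0\<close> makes the first \<open>M\<close> letters all 0;
      \<open>h = 1\<close> makes the letters at \<open>m\<close> and \<open>Suc m\<close>
      differ.\<close>
    proof (cases h)
      case zero
      have "V k = 0" if "k < M" for k
        using that
      proof (induction k)
        case 0
        then show ?case using V_mult[of 0] by simp
      next
        case (Suc k)
        then show ?case using step[of k] zero by simp
      qed
      with both(2) show False by auto
    next
      case one
      with step[of m] m show False by (cases "V m") (simp_all add: M_def)
    qed
  qed
  then show ?thesis by blast
qed

section \<open>Excluding rank one\<close>

text \<open>When \<open>x\<close> and \<open>y\<close> are joined by \<open>a\<close> ones, both
  start with \<open>v\<close>, so both occur at multiples of \<open>l\<close> and \<open>l\<close>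
  divides \<open>length x + a\<close>. It also divides \<open>length x + s\<close>, and
  \<open>a\<close> and \<open>s\<close> are below \<open>l\<close>, so \<open>a = s\<close>.\<close>

lemma spaced_closure_shape:
  assumes mult: "\<And>p. occurs_at v p V \<Longrightarrow> l dvd p"
    and s: "s < l" "l dvd length v + s"
    and "x \<in> spaced_closure {v}" "occurs_at x p V"
  shows "\<exists>n. x @ replicate s 1 = concat (replicate n (v @ replicate s 1))"
proof -
  let ?u = "v @ replicate s (1 :: bit)"
  \<comment> \<open>The first conjunct strengthens the induction: an occurrence of \<open>x\<close>
    then yields one of \<open>v\<close>, to which \<open>mult\<close> applies.\<close>
  have "(\<exists>y. x = v @ y) \<and> (\<exists>n. x @ replicate s 1 = concat (replicate n ?u))"
    using assms(4,5)
  proof (induction arbitrary: p)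
    case (base x)
    then show ?case by (auto intro: exI[of _ 1])
  next
    case (join x y a)
    let ?p = "p + length x + a"
    have occ: "occurs_at x p V" "occurs_at (replicate a 1) (p + length x) V" "occurs_at y ?p V"
      using join.prems by (simp_all add: occurs_at_append)
    obtain x' y' n n' where x: "x = v @ x'" "x @ replicate s 1 = concat (replicate n ?u)"
      and y: "y = v @ y'" "y @ replicate s 1 = concat (replicate n' ?u)"
      using join.IH(1)[OF occ(1)] join.IH(2)[OF occ(3)] by blast
    have "l dvd p" "l dvd ?p"
      using occ(1,3) by (auto simp: x(1) y(1) occurs_at_append intro: mult)
    then have "l dvd length x + a"
      by (metis add.assoc dvd_add_right_iff)
    moreover have "length x + s = n * length ?u"
      using arg_cong[OF x(2), of length] by (simp add: length_concat sum_list_replicate)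
    then have "l dvd length x + s"
      using s(2) by (metis dvd_mult length_append length_replicate)
    \<comment> \<open>One of these truncated differences is 0; using both avoids deciding which of
      \<open>a\<close> and \<open>s\<close> is larger.\<close>
    ultimately have "l dvd a - s" "l dvd s - a"
      using dvd_diff_nat[of l "length x + a" "length x + s"]
        dvd_diff_nat[of l "length x + s" "length x + a"] by simp_all
    moreover have "a < l"
      using occ(2) by (rule V_ones_run)
    ultimately have "a = s"
      using s(1) dvd_imp_le[of l "a - s"] dvd_imp_le[of l "s - a"] by linarith
    then have "(x @ replicate a 1 @ y) @ replicate s 1 = (x @ replicate s 1) @ (y @ replicate s 1)"
      by simp
    also have "\<dots> = concat (replicate (n + n') ?u)"
      unfolding x(2) y(2) by (simp only: replicate_add concat_append)
    finally have "\<exists>n. (x @ replicate a 1 @ y) @ replicate s 1 = concat (replicate n ?u)" ..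
    moreover have "\<exists>z. x @ replicate a 1 @ y = v @ z"
      by (simp add: x(1))
    ultimately show ?case by simp
  qed
  then show ?thesis by blast
qed

lemma not_spacer_rank_one:
  assumes "\<not> periodic_word V"
  shows "\<not> at_most_spacer_rank 1 V"
proof
  assume "at_most_spacer_rank 1 V"
  then obtain N :: "nat \<Rightarrow> nat" and w where N: "\<And>i. 1 \<le> N i \<and> N i \<le> 1"
    and zb: "\<And>i. w i ` {1..N i} \<subseteq> zero_bounded_words"
    and built: "\<And>i. built_from_starting (w i ` {1..N i}) (w i 1) (w (Suc i) 1)"
    and pre: "\<And>i. prefix_of_infinite (w i 1) V"
    unfolding at_most_spacer_rank_def by blast
  have [simp]: "N i = 1" for i using N[of i] by simp
  have longer: "i < length (w i 1)" for i
  proof (induction i)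
    case 0
    then show ?case using zb[of 0] by (auto simp: zero_bounded_words_def)
  next
    case (Suc i)
    then show ?case using built_from_starting_longer[OF built[of i] zb[of i]] by simp
  qed
  obtain L where L: "\<And>p. (\<forall>t<L. V (p + t) = V t) \<Longrightarrow> l dvd p"
    using prefix_occurs_only_at_multiples[OF assms] by blast
  \<comment> \<open>Words at level \<open>i\<close> are longer than \<open>i\<close>, so this prefix
    of \<open>V\<close> contains the first \<open>L\<close> letters and occurs only at multiples of
    \<open>l\<close>.\<close>
  define v where "v = w L 1"
  have mult: "l dvd p" if "occurs_at v p V" for p
    using that pre[of L] longer[of L] unfolding v_def prefix_of_infinite_iff_occurs_at
    by (intro L) (auto simp: occurs_at_def)
  have clos: "w (L + d) 1 \<in> spaced_closure {v}" for d
  proof (induction d)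
    case 0
    then show ?case by (simp add: v_def spaced_closure.base)
  next
    case (Suc d)
    then show ?case
      using built_from_starting_in_spaced_closure[OF built[of "L + d"], of "{v}"] by simp
  qed
  \<comment> \<open>The least \<open>s\<close> for which \<open>l\<close> divides
    \<open>length v + s\<close>; the outer \<open>mod\<close> covers the case where \<open>l\<close>
    already divides \<open>length v\<close>.\<close>
  define s where "s = (l - length v mod l) mod l"
  have s: "s < l" "l dvd length v + s"
  proof -
    show "s < l" using l_gt_1 by (simp add: s_def)
    have "(length v + s) mod l = (length v mod l + (l - length v mod l)) mod l"
      by (simp add: s_def mod_add_left_eq mod_add_right_eq)
    also have "\<dots> = 0" using l_gt_1 by (simp add: less_imp_le)
    finally show "l dvd length v + s" by (simp add: dvd_eq_mod_eq_0)
  qed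
  let ?u = "v @ replicate s 1"
  have "V m = ?u ! (m mod length ?u)" for m
  proof -
    \<comment> \<open>Level \<open>L + m\<close> is long enough to contain position
      \<open>m\<close>, while the period does not depend on \<open>m\<close>.\<close>
    let ?x = "w (L + m) 1"
    have occ: "occurs_at ?x 0 V"
      using pre by (simp add: prefix_of_infinite_iff_occurs_at)
    obtain n where n: "?x @ replicate s 1 = concat (replicate n ?u)"
      using spaced_closure_shape[OF mult s clos occ] by blast
    have m: "m < length ?x" using longer[of "L + m"] by simp
    then have "V m = (?x @ replicate s 1) ! m"
      using occ by (simp add: occurs_at_def nth_append)
    also have "\<dots> = ?u ! (m mod length ?u)"
      unfolding n
    proof (rule nth_concat_replicate)
      have "length ?x + s = n * length ?u"
        using arg_cong[OF n, of length] by (simp add: length_concat sum_list_replicate)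
      with m show "m < n * length ?u" by linarith
    qed
    finally show ?thesis .
  qed
  moreover have "?u \<noteq> []" using longer[of L] by (auto simp: v_def)
  ultimately show False using assms unfolding periodic_word_def by blast
qed

section \<open>Construction with two words per level\<close>

lemma spacer_rank_at_most_two: "at_most_spacer_rank 2 V"
proof -
  let ?X = "\<lambda>n a. (subst_ext \<zeta> ^^ n) [a]"
  \<comment> \<open>The index is \<open>Suc n\<close> because the zeroth iterate of
    \<open>[1]\<close> does not start with 0.\<close>
  have "\<exists>u c. ?X (Suc n) a = u @ replicate c 1 \<and> u \<in> zero_bounded_words" for n a
  proof (rule strip_ones_exists)
    have len: "length (?X n a) = l ^ n" "length (?X (Suc n) a) = l ^ Suc n"
      using length_subst_ext_funpow[of \<zeta> l n "[a]"] length_subst_ext_funpow[of \<zeta> l "Suc n" "[a]"]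
        length_block by simp_all
    then show "?X (Suc n) a \<noteq> []" using l_gt_1 by auto
    have "?X (Suc n) a ! (0 * l + 0) = \<zeta> (?X n a ! 0) ! 0"
      unfolding funpow.simps o_def
      using len(1) l_gt_1 by (intro nth_subst_ext length_block) auto
    then show "?X (Suc n) a ! 0 = 0" by (simp add: first_letter)
  qed
  then obtain U C where X: "\<And>n a. ?X (Suc n) a = U n a @ replicate (C n a) 1"
    and U: "\<And>n a. U n a \<in> zero_bounded_words"
    by metis
  have U0: "built_from_starting {[0]} [0] (U 1 a)" for a
  proof (rule built_from_zero[OF U])
    \<comment> \<open>The second block of the second iterate starts with a 0 at position
      \<open>l\<close>, which stripping trailing ones cannot remove.\<close>
    show "length (U 1 a) > 1"
    proof (rule ccontr)
      assume *: "\<not> length (U 1 a) > 1"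
      have "?X (Suc 1) a = subst_ext \<zeta> (\<zeta> a)"
        by (simp add: subst_ext_def)
      moreover have "subst_ext \<zeta> (\<zeta> a) ! (1 * l + 0) = \<zeta> (\<zeta> a ! 1) ! 0"
        using l_gt_1 length_block by (intro nth_subst_ext) auto
      ultimately have "?X (Suc 1) a ! l = 0" by (simp add: first_letter)
      moreover have "l < length (?X (Suc 1) a)"
        using length_subst_ext_funpow[of \<zeta> l "Suc 1" "[a]"] length_block l_gt_1 by simp
      ultimately show False
        using * l_gt_1 unfolding X by (simp add: nth_append)
    qed
  qed
  have U_Suc: "built_from_starting {U n 0, U n 1} (U n 0) (U (Suc n) a)" for n a
  proof -
    have letters: "U n b \<in> {U n 0, U n 1}" for b by (cases b) simp_all
    have len: "length (\<zeta> a) > 1" using length_block l_gt_1 by simp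
    then obtain bs where bs: "\<zeta> a = 0 # bs" "bs \<noteq> []"
      using first_letter[of a] by (cases "\<zeta> a") auto
    \<comment> \<open>Splitting off the image of the leading 0 of \<open>\<zeta> a\<close> makes
      \<open>U n 0\<close> the first factor for both letters \<open>a\<close>.\<close>
    have "?X (Suc (Suc n)) a = U n 0 @ replicate (C n 0) 1 @ concat (map (?X (Suc n)) bs)"
      unfolding subst_ext_funpow_Suc_letter[of "Suc n"] bs
      by (subst subst_ext_funpow_concat) (simp add: X del: funpow.simps)
    moreover have "\<exists>z\<in>{U n 0, U n 1}. \<exists>c. ?X (Suc n) b = z @ replicate c 1" for b
      using letters[of b] X[of n b] by (intro bexI exI)
    then obtain w c where w: "U n 0 @ replicate (C n 0) 1 @ concat (map (?X (Suc n)) bs) =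
        w @ replicate c 1" "built_from_starting {U n 0, U n 1} (U n 0) w"
      using built_from_starting_append_ones[of "U n 0" "{U n 0, U n 1}" bs "?X (Suc n)" "C n 0"]
        bs(2) by auto
    ultimately have "U (Suc n) a @ replicate (C (Suc n) a) 1 = w @ replicate c 1"
      by (simp only: X)
    moreover have "w \<in> zero_bounded_words"
      using U by (intro built_from_starting_hd_last[OF w(2)]) simp
    ultimately have "U (Suc n) a = w"
      by (rule strip_ones_unique[OF _ U])
    with w(2) show ?thesis by simp
  qed
  define N :: "nat \<Rightarrow> nat" where "N i = (if i = 0 then 1 else 2)" for i
  \<comment> \<open>\<open>U 0\<close> is skipped: it may consist of \<open>[0]\<close> only, which is not built from \<open>{[0]}\<close> since \<open>k \<ge> 1\<close>.\<close>
  define v :: "nat \<Rightarrow> nat \<Rightarrow> word"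
    where "v i j = (if i = 0 then [0] else U i (if j = 1 then 0 else 1))" for i j
  have v_range: "v i ` {1..N i} = (if i = 0 then {[0]} else {U i 0, U i 1})" for i
  proof -
    have "{1..2} = {1, 2 :: nat}" by auto
    then show ?thesis by (auto simp: v_def N_def)
  qed
  have v_built: "built_from_starting (v i ` {1..N i}) (v i 1) (v (Suc i) j)" for i j
    unfolding v_range using U0 U_Suc[of i] by (cases i) (simp_all add: v_def)
  have "prefix_of_infinite (v i 1) V" for i
  proof (cases "i = 0")
    case True
    then show ?thesis
      using V_mult[of 0] by (simp add: v_def prefix_of_infinite_def)
  next
    case False
    then show ?thesis
      using prefix[of "Suc i"] unfolding X
      by (simp add: v_def prefix_of_infinite_iff_occurs_at occurs_at_append)
  qed
  moreover have "v i ` {1..N i} \<subseteq> zero_bounded_words" for i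
    unfolding v_range using U by (simp add: zero_bounded_words_def)
  moreover have "1 \<le> N i \<and> N i \<le> 2" "\<forall>j\<in>{1..N 0}. v 0 j = [0]" for i
    by (simp_all add: N_def v_def)
  ultimately show ?thesis
    unfolding at_most_spacer_rank_def
    using v_built built_from_starting_imp_built_from[OF v_built]
    by (intro exI[of _ N] exI[of _ v]) simp
qed

end

theorem theorem3p24:
  fixes \<zeta> :: "bit \<Rightarrow> bit list" and V :: "nat \<Rightarrow> bit"
  assumes "substitution \<zeta>"
    and "proper_subst \<zeta>"
    and "constant_length \<zeta>"
    and "word_limit (\<lambda>n. (subst_ext \<zeta> ^^ n) [0]) V"
    and "\<not> periodic_word V"
    and "\<forall>a. hd (\<zeta> a) \<noteq> last (\<zeta> a)"
  shows "spacer_rank_two V"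
proof -
  define l where "l = length (\<zeta> 0)"
  have l: "length (\<zeta> a) = l" for a
    using assms(3) by (cases a) (simp_all add: l_def constant_length_def)
  have l1: "l > 1"
    using assms(1) by (simp add: l_def substitution_def)
  \<comment> \<open>Properness carries the first letter 0 of \<open>\<zeta> 0\<close> over to
    \<open>\<zeta> 1\<close>; the last letters, being different from it, are then 1.\<close>
  have hd0: "hd (\<zeta> a) = 0" for a
    using assms(1,2) by (cases a) (simp_all add: substitution_def proper_subst_def)
  have ne: "\<zeta> a \<noteq> []" for a
    using l[of a] l1 by auto
  have first: "\<zeta> a ! 0 = 0" for a
    using hd0 ne by (simp add: hd_conv_nth)
  have last: "\<zeta> a ! (l - 1) = 1" for a
    using assms(6) hd0[of a] ne[of a] l[of a] by (metis bit_not_zero_iff last_conv_nth)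
  interpret zero_one_fixed_point \<zeta> V l
    by unfold_locales (use l l1 first last word_limit_prefix[OF l l1 first assms(4)] in auto)
  show ?thesis
    using spacer_rank_at_most_two not_spacer_rank_one[OF assms(5)]
    by (simp add: spacer_rank_two_def)
qed

end
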